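(* Let $(X,d)$ be a Ptolemy metric space and let $p\in X$ be an arbitrary point. For $x,y\in X\setminus\{p\}$ put $$\chi_p(x,y)=\log\left(1+\frac{d(x,y)}{d(p,x)\,d(p,y)}\right).$$ Then the metric space $(X\setminus\{p\},\chi_p)$ is a strongly hyperbolic space with parameter $2$. Consequently, $(X\setminus\{p\},\chi_p)$ is a $\frac{\log 2}{2}$-hyperbolic space.
   Context: A metric space $(X,d)$ is called a Ptolemy space if $d(x_1,x_2)d(x_3,x_4)\leq d(x_1,x_4)d(x_2,x_3)+d(x_1,x_3)d(x_2,x_4)$ for all $x_1,x_2,x_3,x_4\in X$. For a metric space $(Y,\rho)$ and $x,y,o\in Y$, the Gromov product is $(x|y)_o=\frac12(\rho(o,x)+\rho(o,y)-\rho(x,y))$. $(Y,\rho)$ is $\delta$-hyperbolic ($\delta\geq 0$) if $(x|y)_o\geq \min\{(x|z)_o,(z|y)_o\}-\delta$ for all $x,y,z,o\in Y$. $(Y,\rho)$ is strongly hyperbolic with parameter $\epsilon>0$ if $\exp(-\epsilon(x|y)_o)\leq \exp(-\epsilon(x|z)_o)+\exp(-\epsilon(z|y)_o)$ for all $x,y,z,o\in Y$; equivalently, $\exp(\frac{\epsilon}{2}(\rho(x,y)+\rho(z,t)))\leq \exp(\frac{\epsilon}{2}(\rho(x,z)+\rho(y,t)))+\exp(\frac{\epsilon}{2}(\rho(x,t)+\rho(z,y)))$ for all $x,y,z,t\in Y$. *)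

theory Defs
  imports "HOL-Analysis.Analysis"
begin

locale Ptolemy_space = Metric_space M d for M :: "'a set" and d :: "'a \<Rightarrow> 'a \<Rightarrow> real" +
  assumes ptolemy:
    "\<lbrakk>x1 \<in> M; x2 \<in> M; x3 \<in> M; x4 \<in> M\<rbrakk>
      \<Longrightarrow> d x1 x2 * d x3 x4 \<le> d x1 x4 * d x2 x3 + d x1 x3 * d x2 x4"

definition gromov_product :: "('a \<Rightarrow> 'a \<Rightarrow> real) \<Rightarrow> 'a \<Rightarrow> 'a \<Rightarrow> 'a \<Rightarrow> real" where
  "gromov_product \<rho> z x y = (\<rho> z x + \<rho> z y - \<rho> x y) / 2"  \<comment> \<open>the base point comes first\<close>

locale Gromov_hyperbolic_space = Metric_space M d
  for M :: "'a set" and d :: "'a \<Rightarrow> 'a \<Rightarrow> real" +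
  fixes \<delta> :: real
  assumes delta_nonneg: "\<delta> \<ge> 0"
    and gromov_hyperbolic:
      "\<lbrakk>x \<in> M; y \<in> M; z \<in> M; w \<in> M\<rbrakk>
        \<Longrightarrow> gromov_product d w x y \<ge> min (gromov_product d w x z) (gromov_product d w z y) - \<delta>"

locale Strongly_hyperbolic_space = Metric_space M d
  for M :: "'a set" and d :: "'a \<Rightarrow> 'a \<Rightarrow> real" +
  fixes \<epsilon> :: real
  assumes eps_pos: "\<epsilon> > 0"
    and strongly_hyperbolic:
      "\<lbrakk>x \<in> M; y \<in> M; z \<in> M; w \<in> M\<rbrakk>
        \<Longrightarrow> exp (- \<epsilon> * gromov_product d w x y)
            \<le> exp (- \<epsilon> * gromov_product d w x z) + exp (- \<epsilon> * gromov_product d w z y)"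

text \<open>Only the values at points other than \<open>p\<close> are meant; if \<open>x\<close> or \<open>y\<close> is \<open>p\<close>, the quotient
  is \<open>0\<close> by the convention on division by zero. So \<open>chi\<close> is total, and it is nonnegative and
  symmetric everywhere, as \<open>Metric_space\<close> demands even off the carrier.\<close>

definition chi :: "('a \<Rightarrow> 'a \<Rightarrow> real) \<Rightarrow> 'a \<Rightarrow> 'a \<Rightarrow> 'a \<Rightarrow> real" where
  "chi d p x y = ln (1 + d x y / (d p x * d p y))"

end

theory Submission
  imports Defs
begin

text \<open>
  The metric \<open>chi d p\<close> arises in two steps: it is \<open>ln (1 + e)\<close> for the function
  \<open>e x y = d x y / (d p x * d p y)\<close>, the inversion of \<open>d\<close> at \<open>p\<close>.

  Inversion stays inside the class of Ptolemy spaces (\<open>Ptolemy_space_inversion\<close>). The triangle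
  inequality of \<open>e\<close> is the Ptolemy inequality of \<open>d\<close> for quadruples that contain \<open>p\<close>, and the
  Ptolemy inequality of \<open>e\<close> is the one of \<open>d\<close> divided by the product of the four distances to \<open>p\<close>.

  For a Ptolemy metric \<open>e\<close>, the metric \<open>ln (1 + e)\<close> is strongly hyperbolic with parameter 2
  (\<open>Ptolemy_imp_Strongly_hyperbolic_log\<close>). In the four-point form, the parameter 2 cancels the
  halves in the Gromov products, so that exponentials of \<open>ln (1 + e)\<close> become factors \<open>1 + e\<close> and
  the claim reads
  \<open>(1 + e x y) * (1 + e w z) \<le> (1 + e x z) * (1 + e w y) + (1 + e z y) * (1 + e w x)\<close>.
  After expansion, the quadratic terms are compared by the Ptolemy inequality. The linear terms say
  that the two diagonals of a quadrilateral are together at most as long as its perimeter, which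
  follows from the triangle inequality.

  Finally, strong hyperbolicity with parameter \<open>\<epsilon>\<close> always gives Gromov hyperbolicity with constant
  \<open>ln 2 / \<epsilon>\<close> (\<open>Strongly_hyperbolic_imp_Gromov_hyperbolic\<close>), since a sum of two terms is at most
  twice the larger one.
\<close>

text \<open>The triangle inequality comes from the Ptolemy inequality for the quadruple formed by
  \<open>p\<close> and the three given points.\<close>

lemma Ptolemy_space_inversion:
  fixes X :: "'a set" and d :: "'a \<Rightarrow> 'a \<Rightarrow> real"
  assumes "Ptolemy_space X d" and p: "p \<in> X"
  shows "Ptolemy_space (X - {p}) (\<lambda>x y. d x y / (d p x * d p y))"
proof -
  interpret Ptolemy_space X d by fact
  have pos: "d p x > 0" if "x \<in> X - {p}" for x
    using that p mdist_pos_eq by auto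
  show ?thesis
  proof
    fix x y
    show "0 \<le> d x y / (d p x * d p y)" by simp
    show "d x y / (d p x * d p y) = d y x / (d p y * d p x)"
      by (simp add: commute mult.commute)
  next
    fix x y assume xy: "x \<in> X - {p}" "y \<in> X - {p}"
    show "d x y / (d p x * d p y) = 0 \<longleftrightarrow> x = y"
      using pos[OF xy(1)] pos[OF xy(2)] xy by auto
  next
    fix x y z assume xyz: "x \<in> X - {p}" "y \<in> X - {p}" "z \<in> X - {p}"
    have "d x z * d p y \<le> d x y * d p z + d y z * d p x"
      using ptolemy[of x z p y] xyz p by (simp add: commute algebra_simps)
    then show "d x z / (d p x * d p z) \<le> d x y / (d p x * d p y) + d y z / (d p y * d p z)"
      using xyz[THEN pos] by (simp add: field_simps)
  next
    fix x1 x2 x3 x4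
    assume x: "x1 \<in> X - {p}" "x2 \<in> X - {p}" "x3 \<in> X - {p}" "x4 \<in> X - {p}"
    have "d x1 x2 * d x3 x4 \<le> d x1 x4 * d x2 x3 + d x1 x3 * d x2 x4"
      using ptolemy x by blast
    then have "d x1 x2 * d x3 x4 / (d p x1 * d p x2 * d p x3 * d p x4)
      \<le> (d x1 x4 * d x2 x3 + d x1 x3 * d x2 x4) / (d p x1 * d p x2 * d p x3 * d p x4)"
      by (intro divide_right_mono) auto
    then show "d x1 x2 / (d p x1 * d p x2) * (d x3 x4 / (d p x3 * d p x4))
      \<le> d x1 x4 / (d p x1 * d p x4) * (d x2 x3 / (d p x2 * d p x3))
        + d x1 x3 / (d p x1 * d p x3) * (d x2 x4 / (d p x2 * d p x4))"
      by (simp add: add_divide_distrib mult_ac)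
  qed
qed

lemma Metric_space_log:
  assumes "Metric_space M e"
  shows "Metric_space M (\<lambda>x y. ln (1 + e x y))"
proof -
  interpret Metric_space M e by fact
  have pos: "1 + e x y > 0" for x y
    by (simp add: add_pos_nonneg)
  show ?thesis
  proof
    fix x y
    show "0 \<le> ln (1 + e x y)" by simp
    show "ln (1 + e x y) = ln (1 + e y x)" by (simp add: commute)
  next
    fix x y assume "x \<in> M" "y \<in> M"
    then show "ln (1 + e x y) = 0 \<longleftrightarrow> x = y"
      using pos[of x y] zero by (simp add: ln_eq_zero_iff)
  next
    fix x y z assume "x \<in> M" "y \<in> M" "z \<in> M"
    then have "1 + e x z \<le> 1 + (e x y + e y z)"
      using triangle by simp
    also have "\<dots> \<le> (1 + e x y) * (1 + e y z)"
      by (simp add: algebra_simps)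
    finally have "ln (1 + e x z) \<le> ln ((1 + e x y) * (1 + e y z))"
      using pos by (simp add: ln_le_cancel_iff)
    then show "ln (1 + e x z) \<le> ln (1 + e x y) + ln (1 + e y z)"
      using pos by (simp add: ln_mult_pos)
  qed
qed

text \<open>The sum of the diagonals of the quadrilateral \<open>x\<close>, \<open>z\<close>, \<open>y\<close>, \<open>w\<close> is bounded by its
  perimeter, and their product by the Ptolemy inequality. The constant terms, 1 against 2, leave room to spare.\<close>

lemma Ptolemy_four_point_one_plus:
  assumes "Ptolemy_space M e" and "x \<in> M" "y \<in> M" "z \<in> M" "w \<in> M"
  shows "(1 + e x y) * (1 + e w z)
    \<le> (1 + e x z) * (1 + e w y) + (1 + e z y) * (1 + e w x)"
proof -
  interpret Ptolemy_space M e by fact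
  \<comment> \<open>each diagonal cuts the quadrilateral into two triangles, which gives four inequalities\<close>
  have "e x y \<le> e x z + e z y" "e x y \<le> e w x + e w y"
    "e w z \<le> e w x + e x z" "e w z \<le> e w y + e z y"
    using assms triangle[of x z y] triangle[of x w y] triangle[of w x z] triangle[of w y z]
    by (simp_all add: commute)
  then have "e x y + e w z \<le> e x z + e z y + e w y + e w x"
    by linarith
  moreover have "e x y * e w z \<le> e x z * e w y + e z y * e w x"
    using ptolemy[of x y w z] assms by (simp add: commute mult_ac)
  ultimately show ?thesis
    by (simp add: algebra_simps)
qed

lemma Ptolemy_imp_Strongly_hyperbolic_log:
  assumes "Ptolemy_space M e"
  shows "Strongly_hyperbolic_space M (\<lambda>x y. ln (1 + e x y)) 2"
proof -
  interpret Ptolemy_space M e by fact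
  interpret log: Metric_space M "\<lambda>x y. ln (1 + e x y)"
    by (rule Metric_space_log) unfold_locales
  have pos: "1 + e x y > 0" for x y
    by (simp add: add_pos_nonneg)
  have exp_product: "exp (- 2 * gromov_product (\<lambda>x y. ln (1 + e x y)) w x y)
      = (1 + e x y) / ((1 + e w x) * (1 + e w y))" for w x y
  proof -
    have "- 2 * gromov_product (\<lambda>x y. ln (1 + e x y)) w x y
        = ln (1 + e x y) - (ln (1 + e w x) + ln (1 + e w y))"
      by (simp add: gromov_product_def)
    then show ?thesis
      using pos by (simp add: exp_diff exp_add)
  qed
  show ?thesis
  proof
    fix x y z w assume M: "x \<in> M" "y \<in> M" "z \<in> M" "w \<in> M"
    show "exp (- 2 * gromov_product (\<lambda>x y. ln (1 + e x y)) w x y)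
      \<le> exp (- 2 * gromov_product (\<lambda>x y. ln (1 + e x y)) w x z)
        + exp (- 2 * gromov_product (\<lambda>x y. ln (1 + e x y)) w z y)"
      unfolding exp_product
    proof -
      define a b c where "a = 1 + e w x" and "b = 1 + e w y" and "c = 1 + e w z"
      have abc: "a > 0" "b > 0" "c > 0"
        using pos by (simp_all add: a_def b_def c_def)
      have "(1 + e x y) * c \<le> (1 + e x z) * b + (1 + e z y) * a"
        using Ptolemy_four_point_one_plus[OF assms M] by (simp add: a_def b_def c_def)
      then have "(1 + e x y) * c / (a * b * c) \<le> ((1 + e x z) * b + (1 + e z y) * a) / (a * b * c)"
        using abc by (intro divide_right_mono) auto
      then have "(1 + e x y) / (a * b) \<le> (1 + e x z) / (a * c) + (1 + e z y) / (c * b)"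
        using abc by (simp add: add_divide_distrib mult_ac)
      then show "(1 + e x y) / ((1 + e w x) * (1 + e w y))
        \<le> (1 + e x z) / ((1 + e w x) * (1 + e w z)) + (1 + e z y) / ((1 + e w z) * (1 + e w y))"
        by (simp add: a_def b_def c_def)
    qed
  qed simp
qed

lemma Strongly_hyperbolic_imp_Gromov_hyperbolic:
  assumes "Strongly_hyperbolic_space M \<rho> \<epsilon>"
  shows "Gromov_hyperbolic_space M \<rho> (ln 2 / \<epsilon>)"
proof -
  interpret Strongly_hyperbolic_space M \<rho> \<epsilon> by fact
  show ?thesis
  proof
    show "0 \<le> ln 2 / \<epsilon>"
      using eps_pos by simp
  next
    fix x y z w assume M: "x \<in> M" "y \<in> M" "z \<in> M" "w \<in> M"
    define m where "m = min (gromov_product \<rho> w x z) (gromov_product \<rho> w z y)"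
    have "exp (- \<epsilon> * gromov_product \<rho> w x y)
        \<le> exp (- \<epsilon> * gromov_product \<rho> w x z) + exp (- \<epsilon> * gromov_product \<rho> w z y)"
      using strongly_hyperbolic M by blast
    also have "\<dots> \<le> exp (- \<epsilon> * m) + exp (- \<epsilon> * m)"
      using eps_pos by (intro add_mono) (simp_all add: m_def)
    also have "\<dots> = exp (ln 2 - \<epsilon> * m)"
      by (simp add: exp_diff exp_minus field_simps)
    finally have "- \<epsilon> * gromov_product \<rho> w x y \<le> ln 2 - \<epsilon> * m"
      by simp
    then have "m - ln 2 / \<epsilon> \<le> gromov_product \<rho> w x y"
      using eps_pos by (simp add: field_simps)
    then show "min (gromov_product \<rho> w x z) (gromov_product \<rho> w z y) - ln 2 / \<epsilon>
        \<le> gromov_product \<rho> w x y"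
      by (simp add: m_def)
  qed
qed

theorem theorem7:
  fixes X :: "'a set" and d :: "'a \<Rightarrow> 'a \<Rightarrow> real" and p :: 'a
  assumes "Ptolemy_space X d" and "p \<in> X"
  shows "Strongly_hyperbolic_space (X - {p}) (chi d p) 2
    \<and> Gromov_hyperbolic_space (X - {p}) (chi d p) (ln 2 / 2)"
proof -
  have "chi d p = (\<lambda>x y. ln (1 + d x y / (d p x * d p y)))"
    by (simp add: chi_def fun_eq_iff)
  then have "Strongly_hyperbolic_space (X - {p}) (chi d p) 2"
    using Ptolemy_imp_Strongly_hyperbolic_log[OF Ptolemy_space_inversion[OF assms]] by simp
  then show ?thesis
    using Strongly_hyperbolic_imp_Gromov_hyperbolic by blast
qed

end
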